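(* Let $m,n$ be positive integers. A tight signed magic array $SMA(m,n)$ exists if and only if one of the following holds: $m=n=1$; or $m=2$ and $n\equiv 0$ or $3 \pmod 4$; or $n=2$ and $m\equiv 0$ or $3\pmod 4$; or $m>2$ and $n>2$.
   Context: For positive integers $m,n$, a tight signed magic array $SMA(m,n)$ is an $m\times n$ array with every cell filled, whose entries come from the set $X$, where $X=\{0,\pm1,\pm2,\ldots,\pm (mn-1)/2\}$ if $mn$ is odd and $X=\{\pm1,\pm2,\ldots,\pm mn/2\}$ if $mn$ is even, such that every integer in $X$ appears exactly once in the array and every row sum and every column sum is zero. *)

theory Defs
  imports Main
begin

text \<open>The divisions by 2 are exact in both branches, and for even \<open>m * n\<close> the value 0 is excluded.\<close>

definition sma_entries :: "nat \<Rightarrow> nat \<Rightarrow> int set" where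
  "sma_entries m n =
     (if odd (m * n)
      then {- ((int (m * n) - 1) div 2) .. (int (m * n) - 1) div 2}
      else {- (int (m * n) div 2) .. int (m * n) div 2} - {0})"

text \<open>An \<open>m \<times> n\<close> array is a function of the row index \<open>i < m\<close> and the column index \<open>j < n\<close>;
  its values outside this range are irrelevant.  The bijection says that every cell
  holds an element of the entry set and that each such element occurs in exactly one cell.\<close>

definition tight_signed_magic_array :: "nat \<Rightarrow> nat \<Rightarrow> (nat \<Rightarrow> nat \<Rightarrow> int) \<Rightarrow> bool" where
  "tight_signed_magic_array m n A \<longleftrightarrow>
     bij_betw (\<lambda>(i, j). A i j) ({..<m} \<times> {..<n}) (sma_entries m n) \<and>
     (\<forall>i<m. (\<Sum>j<n. A i j) = 0) \<and>
     (\<forall>j<n. (\<Sum>i<m. A i j) = 0)"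

end

theory Submission
  imports Defs
begin

text \<open>With two rows an array is a row \<open>r\<close> above \<open>-r\<close>, so it exists iff the numbers \<open>1, \<dots>, n\<close> can be
  signed to have sum 0, i.e. iff \<open>n (n + 1) / 2\<close> is even.  Larger arrays grow from smaller ones by
  adding pairs of rows \<open>r, -r\<close> (when \<open>n\<close> is even) or by surrounding them with a frame whose
  opposite entries cancel (when \<open>n\<close> is odd, where pairs of rows are impossible once the array is large),
  always using the next larger absolute values.  This reduces everything to \<open>m = 3\<close>
  and to \<open>m = 5\<close>, \<open>n \<equiv> 2 (mod 4)\<close>, the latter being a frame around \<open>3 \<times> (n - 2)\<close>, apart from
  a few small cases given explicitly.  For \<open>m = 3\<close>, the perfect shuffle \<open>i \<mapsto> 2 i\<close> modulo an odd
  number yields triples with sum 0 that use all entries; permuting entries inside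
  the triples then balances the three rows.\<close>

section \<open>Zero-sum arrays\<close>

text \<open>The entry set is arbitrary because intermediate arrays, such as those after two of four
  added rows, may skip absolute values.\<close>

definition zero_sum_array :: "nat \<Rightarrow> nat \<Rightarrow> int set \<Rightarrow> bool" where
  "zero_sum_array m n E \<longleftrightarrow>
     (\<exists>A. bij_betw (\<lambda>(i, j). A i j) ({..<m} \<times> {..<n}) E \<and>
          (\<forall>i<m. (\<Sum>j<n. A i j) = 0) \<and> (\<forall>j<n. (\<Sum>i<m. A i j) = 0))"

lemma ex_tight_iff: "(\<exists>A. tight_signed_magic_array m n A) \<longleftrightarrow> zero_sum_array m n (sma_entries m n)"
  by (simp add: tight_signed_magic_array_def zero_sum_array_def)

text \<open>There are as many cells as prescribed values, so an array that hits every value hits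
  each exactly once and contains nothing else. Later constructions therefore only check
  covering.\<close>

lemma zero_sum_arrayI:
  assumes "E \<subseteq> (\<lambda>(i, j). A i j) ` ({..<m} \<times> {..<n})" and "card E = m * n"
    and "\<And>i. i < m \<Longrightarrow> (\<Sum>j<n. A i j) = 0" and "\<And>j. j < n \<Longrightarrow> (\<Sum>i<m. A i j) = 0"
  shows "zero_sum_array m n E"
proof -
  let ?f = "\<lambda>(i, j). A i j" and ?D = "{..<m} \<times> {..<n}"
  have c: "card ?D = m * n" by simp
  have "card (?f ` ?D) \<le> m * n" using card_image_le[of ?D ?f] by simp
  hence "E = ?f ` ?D" using assms(1,2) by (intro card_seteq) auto
  moreover from this have "inj_on ?f ?D" using assms(2) by (intro eq_card_imp_inj_on) auto
  ultimately show ?thesis using assms(3,4) unfolding zero_sum_array_def bij_betw_def by blast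
qed

lemma zero_sum_arrayE:
  assumes "zero_sum_array m n E"
  obtains A where "E = (\<lambda>(i, j). A i j) ` ({..<m} \<times> {..<n})"
    and "\<And>i. i < m \<Longrightarrow> (\<Sum>j<n. A i j) = 0" and "\<And>j. j < n \<Longrightarrow> (\<Sum>i<m. A i j) = 0"
  using assms unfolding zero_sum_array_def bij_betw_def by blast

lemma zero_sum_array_transpose:
  assumes "zero_sum_array m n E"
  shows "zero_sum_array n m E"
proof -
  obtain A where A: "bij_betw (\<lambda>(i, j). A i j) ({..<m} \<times> {..<n}) E"
    "\<forall>i<m. (\<Sum>j<n. A i j) = 0" "\<forall>j<n. (\<Sum>i<m. A i j) = 0"
    using assms unfolding zero_sum_array_def by blast
  have "bij_betw prod.swap ({..<n} \<times> {..<m}) ({..<m} \<times> {..<n})"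
    by (rule bij_betw_byWitness[of _ prod.swap]) auto
  from bij_betw_trans[OF this A(1)]
  have "bij_betw (\<lambda>(i, j). A j i) ({..<n} \<times> {..<m}) E"
    by (simp add: comp_def case_prod_unfold)
  with A show ?thesis unfolding zero_sum_array_def by (intro exI[of _ "\<lambda>i j. A j i"]) auto
qed

lemma sma_entries_alt:
  "sma_entries m n = {- int (m * n div 2)..int (m * n div 2)} - (if even (m * n) then {0} else {})"
proof (cases "even (m * n)")
  case True
  then obtain k where "m * n = 2 * k" by blast
  with True show ?thesis by (simp add: sma_entries_def)
next
  case False
  then obtain k where "m * n = 2 * k + 1" by (blast elim: oddE)
  then show ?thesis unfolding sma_entries_def by simp
qed

lemma card_sma_entries: "card (sma_entries m n) = m * n"
proof (cases "even (m * n)")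
  case True
  then obtain k where "m * n = 2 * k" by blast
  then show ?thesis by (simp add: sma_entries_alt card_Diff_subset)
next
  case False
  then obtain k where "m * n = 2 * k + 1" by (blast elim: oddE)
  then show ?thesis unfolding sma_entries_alt by simp
qed

text \<open>Equal parity means that 0 lies in both entry sets or in neither, so only the new
  absolute values have to be covered.\<close>

lemma sma_entries_subset:
  assumes "even (m * n) \<longleftrightarrow> even (m' * n')"
    and "{int (m * n div 2) + 1..int (m' * n' div 2)} \<subseteq> S"
  shows "sma_entries m' n' \<subseteq> sma_entries m n \<union> S \<union> uminus ` S"
proof
  fix x assume x: "x \<in> sma_entries m' n'"
  show "x \<in> sma_entries m n \<union> S \<union> uminus ` S"
  proof (cases "\<bar>x\<bar> \<le> int (m * n div 2)")
    case True
    with x show ?thesis unfolding sma_entries_alt assms(1) by (auto split: if_splits)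
  next
    case False
    moreover have "\<bar>x\<bar> \<le> int (m' * n' div 2)" using x unfolding sma_entries_alt by auto
    ultimately have "\<bar>x\<bar> \<in> S" using assms(2) by auto
    then have "x \<in> S \<or> - x \<in> S" by (cases "0 \<le> x") auto
    then show ?thesis by force
  qed
qed

lemma sma_entries_commute: "sma_entries m n = sma_entries n m"
  by (simp add: sma_entries_def mult.commute)

lemma sma_transpose:
  "zero_sum_array m n (sma_entries m n) \<Longrightarrow> zero_sum_array n m (sma_entries n m)"
  using zero_sum_array_transpose sma_entries_commute by metis

section \<open>Signed sums\<close>

text \<open>\<open>T\<close> is \<open>S\<close> with signs attached; equal cardinality prevents
  \<open>x\<close> and \<open>-x\<close> from both occurring.\<close>

definition signed_sum :: "int set \<Rightarrow> int \<Rightarrow> bool" where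
  "signed_sum S t \<longleftrightarrow> (\<exists>T. finite T \<and> card T = card S \<and> abs ` T = S \<and> \<Sum>T = t)"

lemma signed_sum_Un:
  assumes "signed_sum S s" "signed_sum T t" "S \<inter> T = {}"
  shows "signed_sum (S \<union> T) (s + t)"
proof -
  obtain S' where S: "finite S'" "card S' = card S" "abs ` S' = S" "\<Sum>S' = s"
    using assms(1) unfolding signed_sum_def by blast
  obtain T' where T: "finite T'" "card T' = card T" "abs ` T' = T" "\<Sum>T' = t"
    using assms(2) unfolding signed_sum_def by blast
  have d: "S' \<inter> T' = {}" using assms(3) S(3) T(3) by blast
  have "finite S" "finite T" using S T by blast+
  hence "card (S' \<union> T') = card (S \<union> T)"
    using S T d assms(3) by (simp add: card_Un_disjoint)
  moreover have "\<Sum>(S' \<union> T') = s + t" using S T d by (simp add: sum.union_disjoint)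
  ultimately show ?thesis unfolding signed_sum_def
    using S T by (intro exI[of _ "S' \<union> T'"]) (simp add: image_Un)
qed

lemma signed_sum_pos: "finite S \<Longrightarrow> S \<subseteq> {0<..} \<Longrightarrow> signed_sum S (\<Sum>S)"
  unfolding signed_sum_def by (intro exI[of _ S]) force

lemma signed_sum_neg:
  assumes "finite S" "S \<subseteq> {0<..}"
  shows "signed_sum S (- \<Sum>S)"
proof -
  have "abs ` uminus ` S = S" using assms(2) by (force simp: image_image)
  moreover have "\<Sum>(uminus ` S) = - \<Sum>S" by (subst sum.reindex) (auto simp: sum_negf)
  moreover have "card (uminus ` S) = card S" by (rule card_image) auto
  ultimately show ?thesis unfolding signed_sum_def using assms(1)
    by (intro exI[of _ "uminus ` S"]) simp
qed

lemma signed_sum_pair: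
  assumes "0 < x" "x < y"
  shows "signed_sum {x, y} (y - x)" "signed_sum {x, y} (x - y)"
proof -
  show "signed_sum {x, y} (y - x)" unfolding signed_sum_def using assms
    by (intro exI[of _ "{- x, y}"]) simp
  show "signed_sum {x, y} (x - y)" unfolding signed_sum_def using assms
    by (intro exI[of _ "{x, - y}"]) simp
qed

text \<open>Consecutive pairs are signed \<open>+ -\<close> and \<open>- +\<close> in turn,
  contributing -1 and 1, so any four consecutive numbers cancel.\<close>

lemma signed_sum_interval:
  assumes "0 \<le> c"
  shows "signed_sum {c + 1..c + 2 * int j} (- int (j mod 2))"
proof (induction j)
  case 0
  show ?case by (simp add: signed_sum_def)
next
  case (Suc j)
  let ?x = "c + 2 * int j + 1"
  have e: "{c + 1..c + 2 * int (Suc j)} = {c + 1..c + 2 * int j} \<union> {?x, ?x + 1}"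
    using assms by auto
  have "signed_sum {?x, ?x + 1} (int (j mod 2) - int (Suc j mod 2))"
    using signed_sum_pair[of ?x "?x + 1"] assms by (cases "even j") (auto simp: mod_Suc)
  from signed_sum_Un[OF Suc this] show ?case unfolding e by simp
qed

lemma signed_sum_enum:
  assumes "signed_sum S t" "card S = n"
  obtains f :: "nat \<Rightarrow> int" where "S = (\<lambda>i. \<bar>f i\<bar>) ` {..<n}" "(\<Sum>i<n. f i) = t"
proof -
  obtain T where T: "finite T" "card T = card S" "abs ` T = S" "\<Sum>T = t"
    using assms(1) unfolding signed_sum_def by blast
  obtain f where f: "bij_betw f {..<n} T"
    using ex_bij_betw_nat_finite[OF T(1)] T(2) assms(2) by (auto simp: atLeast0LessThan)
  have "abs ` f ` {..<n} = S" using f T by (simp add: bij_betw_def)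
  moreover have "(\<Sum>i<n. f i) = t" using sum.reindex_bij_betw[OF f, of "\<lambda>x. x"] T by simp
  ultimately show ?thesis using that by (auto simp: image_image)
qed

section \<open>Extending arrays\<close>

lemma add_two_rows:
  assumes "zero_sum_array m n E" "signed_sum S 0" "card S = n"
    and "F \<subseteq> E \<union> S \<union> uminus ` S" "card F = (m + 2) * n"
  shows "zero_sum_array (m + 2) n F"
proof -
  obtain A where A: "E = (\<lambda>(i, j). A i j) ` ({..<m} \<times> {..<n})"
    "\<And>i. i < m \<Longrightarrow> (\<Sum>j<n. A i j) = 0" "\<And>j. j < n \<Longrightarrow> (\<Sum>i<m. A i j) = 0"
    using zero_sum_arrayE[OF assms(1)] by metis
  obtain f where f: "S = (\<lambda>i. \<bar>f i\<bar>) ` {..<n}" "(\<Sum>i<n. f i) = 0"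
    using signed_sum_enum[OF assms(2,3)] by metis
  define B where "B i j = (if i < m then A i j else if i = m then f j else - f j)" for i j
  let ?I = "(\<lambda>(i, j). B i j) ` ({..<m + 2} \<times> {..<n})"
  have B: "B i j \<in> ?I" if "i < m + 2" "j < n" for i j
    using that by force
  have "f j \<in> ?I" "- f j \<in> ?I" if "j < n" for j
    using B[of m j] B[of "m + 1" j] that by (simp_all add: B_def)
  moreover have "A i j \<in> ?I" if "i < m" "j < n" for i j
    using B[of i j] that by (simp add: B_def)
  ultimately have "E \<union> S \<union> uminus ` S \<subseteq> ?I"
    unfolding A(1) f(1) by (auto simp: abs_if simp del: add_2_eq_Suc')
  then show ?thesis
  proof (intro zero_sum_arrayI[where A = B])
    fix i assume "i < m + 2"
    then consider "i < m" | "i = m" | "i = m + 1" by linarith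
    then show "(\<Sum>j<n. B i j) = 0"
      by cases (simp_all add: B_def A f sum_negf)
  next
    fix j assume "j < n"
    then show "(\<Sum>i<m + 2. B i j) = 0" by (simp add: B_def A)
  qed (use assms in blast)+
qed

text \<open>Rows \<open>f, p, q\<close> and \<open>-f, -q, -p\<close> and columns \<open>g\<close>
  and \<open>-g\<close> are appended. The sums required of \<open>f\<close> and \<open>g\<close>
  balance row \<open>m\<close> and column \<open>n\<close>; up to order, the last row and column are
  the negatives of these.\<close>

lemma add_frame:
  assumes "zero_sum_array m n E"
    and T: "signed_sum T (- p - q)" "card T = n"
    and L: "signed_sum L (q - p)" "card L = m"
    and F: "F \<subseteq> E \<union> (T \<union> L \<union> {\<bar>p\<bar>, \<bar>q\<bar>}) \<union> uminus ` (T \<union> L \<union> {\<bar>p\<bar>, \<bar>q\<bar>})"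
    and "card F = (m + 2) * (n + 2)"
  shows "zero_sum_array (m + 2) (n + 2) F"
proof -
  obtain A where A: "E = (\<lambda>(i, j). A i j) ` ({..<m} \<times> {..<n})"
    "\<And>i. i < m \<Longrightarrow> (\<Sum>j<n. A i j) = 0" "\<And>j. j < n \<Longrightarrow> (\<Sum>i<m. A i j) = 0"
    using zero_sum_arrayE[OF assms(1)] by metis
  obtain f where f: "T = (\<lambda>i. \<bar>f i\<bar>) ` {..<n}" "(\<Sum>i<n. f i) = - p - q"
    using signed_sum_enum[OF T] by metis
  obtain g where g: "L = (\<lambda>i. \<bar>g i\<bar>) ` {..<m}" "(\<Sum>i<m. g i) = q - p"
    using signed_sum_enum[OF L] by metis
  define B where "B i j =
    (if i < m then if j < n then A i j else if j = n then g i else - g i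
     else if i = m then if j < n then f j else if j = n then p else q
     else if j < n then - f j else if j = n then - q else - p)" for i j
  let ?I = "(\<lambda>(i, j). B i j) ` ({..<m + 2} \<times> {..<n + 2})"
  have B: "B i j \<in> ?I" if "i < m + 2" "j < n + 2" for i j
    using that by force
  have "f j \<in> ?I" "- f j \<in> ?I" if "j < n" for j
    using B[of m j] B[of "m + 1" j] that by (simp_all add: B_def)
  moreover have "g i \<in> ?I" "- g i \<in> ?I" if "i < m" for i
    using B[of i n] B[of i "n + 1"] that by (simp_all add: B_def)
  moreover have "A i j \<in> ?I" if "i < m" "j < n" for i j
    using B[of i j] that by (simp add: B_def)
  moreover have "p \<in> ?I" "- p \<in> ?I" "q \<in> ?I" "- q \<in> ?I"
    using B[of m n] B[of "m + 1" "n + 1"] B[of m "n + 1"] B[of "m + 1" n] by (simp_all add: B_def)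
  ultimately have "E \<union> T \<union> uminus ` T \<union> L \<union> uminus ` L \<union> {p, - p, q, - q} \<subseteq> ?I"
    unfolding A(1) f(1) g(1) by (auto simp: abs_if simp del: add_2_eq_Suc')
  moreover have "F \<subseteq> E \<union> T \<union> uminus ` T \<union> L \<union> uminus ` L \<union> {p, - p, q, - q}"
    using F by (auto simp: abs_if split: if_splits)
  ultimately have "F \<subseteq> ?I" by blast
  then show ?thesis
  proof (intro zero_sum_arrayI[where A = B])
    fix i assume "i < m + 2"
    then consider "i < m" | "i = m" | "i = m + 1" by linarith
    then show "(\<Sum>j<n + 2. B i j) = 0"
      by cases (simp_all add: B_def A f sum_negf)
  next
    fix j assume "j < n + 2"
    then consider "j < n" | "j = n" | "j = n + 1" by linarith
    then show "(\<Sum>i<m + 2. B i j) = 0"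
      by cases (simp_all add: B_def A g sum_negf)
  qed (use assms in simp)+
qed

lemma zero_sum_array_0: "zero_sum_array 0 n (sma_entries 0 n)"
  by (rule zero_sum_arrayI) (auto simp: sma_entries_alt)

text \<open>The \<open>n\<close> new absolute values split into groups of four consecutive numbers,
  each of which can be signed to cancel.\<close>

lemma sma_add_2_rows:
  assumes n: "4 dvd n" and A: "zero_sum_array m n (sma_entries m n)"
  shows "zero_sum_array (m + 2) n (sma_entries (m + 2) n)"
proof -
  obtain k where k: "n = 4 * k" using n by blast
  let ?c = "int (m * n div 2)"
  have c: "int ((m + 2) * n div 2) = ?c + int n" by (simp add: k algebra_simps)
  have S: "signed_sum {?c + 1..?c + int n} 0"
    using signed_sum_interval[of ?c "2 * k"] by (simp add: k)
  show ?thesis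
    by (rule add_two_rows[OF A S _ sma_entries_subset])
      (simp_all only: c card_sma_entries, simp_all add: k)
qed

lemma card_Un_uminus:
  fixes S :: "int set"
  assumes "E \<subseteq> {- c..c}" "finite S" "S \<subseteq> {c<..}" "0 \<le> c"
  shows "card (E \<union> S \<union> uminus ` S) = card E + 2 * card S"
proof -
  have "x < - c" if "x \<in> uminus ` S" for x using that assms(3) by auto
  moreover have "- c \<le> x" if "x \<in> E \<union> S" for x using that assms(1,3,4) by auto
  moreover have "E \<inter> S = {}" using assms(1,3) by force
  ultimately have "E \<inter> S = {}" "(E \<union> S) \<inter> uminus ` S = {}" by (blast, fastforce)
  moreover have "card (uminus ` S) = card S" by (rule card_image) auto
  moreover have "finite E" using assms(1) finite_subset by blast
  ultimately show ?thesis using assms(2) by (simp add: card_Un_disjoint)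
qed

lemma add_four_rows:
  assumes "zero_sum_array m n E" "E \<subseteq> {- c..c}" "card E = m * n" "0 \<le> c"
    and S: "signed_sum S 0" "card S = n" "finite S" "S \<subseteq> {c<..}"
    and T: "signed_sum T 0" "card T = n"
    and F: "F \<subseteq> E \<union> (S \<union> T) \<union> uminus ` (S \<union> T)" "card F = (m + 4) * n"
  shows "zero_sum_array (m + 4) n F"
proof -
  have "zero_sum_array (m + 2) n (E \<union> S \<union> uminus ` S)"
    using add_two_rows[OF assms(1) S(1,2)] card_Un_uminus[OF assms(2) S(3,4)] assms by simp
  moreover have "F \<subseteq> (E \<union> S \<union> uminus ` S) \<union> T \<union> uminus ` T"
    using F(1) unfolding image_Un by blast
  ultimately have "zero_sum_array (m + 2 + 2) n F"
    using add_two_rows[OF _ T] F(2) by (simp add: algebra_simps)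
  then show ?thesis by (simp add: numeral_eq_Suc)
qed

text \<open>For \<open>n \<equiv> 2 (mod 4)\<close> the numbers \<open>c + 1, \<dots>, c + n\<close> have odd sum and cannot be signed to have
  sum 0.  The numbers \<open>c + 1, \<dots>, c + 2 n\<close> however split into two halves that can.\<close>

lemma sma_add_4_rows:
  assumes n: "n mod 4 = 2" "n \<ge> 6" and A: "zero_sum_array m n (sma_entries m n)"
  shows "zero_sum_array (m + 4) n (sma_entries (m + 4) n)"
proof -
  define k where "k = (n - 6) div 4"
  have k: "n = 4 * k + 6" using n unfolding k_def by presburger
  define c where "c = int (m * n div 2)"
  have c0: "0 \<le> c" by (simp add: c_def)
  have c: "int ((m + 4) * n div 2) = c + 12 + 8 * int k" by (simp add: k c_def algebra_simps)
  \<comment> \<open>The first twelve new numbers form two zero-sum sixes, each with three plus and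
    three minus signs so that \<open>c\<close> cancels. The other \<open>8 k\<close> numbers are cut
    into two intervals of length \<open>4 k\<close>.\<close>
  have 1: "signed_sum ({c + 1, c + 2, c + 3, c + 4, c + 5, c + 7} \<union> {c + 12 + 1..c + 12 + 2 * int (2 * k)}) (0 + - int (2 * k mod 2))"
    (is "signed_sum ?S _")
    by (rule signed_sum_Un[OF _ signed_sum_interval])
      (use c0 in \<open>auto simp: signed_sum_def intro!: exI[of _ "{c + 1, - (c + 2), c + 3, - (c + 4), - (c + 5), c + 7}"]\<close>)
  have 2: "signed_sum ({c + 6, c + 8, c + 9, c + 10, c + 11, c + 12} \<union> {c + 12 + 4 * int k + 1..c + 12 + 4 * int k + 2 * int (2 * k)}) (0 + - int (2 * k mod 2))"
    (is "signed_sum ?T _")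
    by (rule signed_sum_Un[OF _ signed_sum_interval])
      (use c0 in \<open>auto simp: signed_sum_def intro!: exI[of _ "{c + 6, - (c + 8), - (c + 9), c + 10, - (c + 11), c + 12}"]\<close>)
  have card: "card ?S = n" "card ?T = n"
    by (subst card_Un_disjoint; simp add: k)+
  let ?E = "sma_entries m n" and ?F = "sma_entries (m + 4) n"
  have F: "?F \<subseteq> ?E \<union> (?S \<union> ?T) \<union> uminus ` (?S \<union> ?T)"
  proof (rule sma_entries_subset)
    show "{int (m * n div 2) + 1..int ((m + 4) * n div 2)} \<subseteq> ?S \<union> ?T"
      unfolding c c_def[symmetric] by (auto; presburger)
  qed (simp add: k)
  have E: "?E \<subseteq> {- c..c}" unfolding sma_entries_alt c_def by auto
  have S: "finite ?S" "?S \<subseteq> {c<..}" by auto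
  have "signed_sum ?S 0" "signed_sum ?T 0" using 1 2 by simp_all
  then show ?thesis
    by (rule add_four_rows[OF A E card_sma_entries c0 _ card(1) S _ card(2) F card_sma_entries])
qed

section \<open>Arrays with three columns\<close>

text \<open>With lists of rows, explicit arrays are checked by evaluation and blocks are stacked by
  \<open>@\<close>.\<close>

definition zero_sum_rows :: "nat \<Rightarrow> int list list \<Rightarrow> bool" where
  "zero_sum_rows k xs \<longleftrightarrow>
     (\<forall>r\<in>set xs. length r = k \<and> sum_list r = 0) \<and> (\<forall>j<k. (\<Sum>r\<leftarrow>xs. r ! j) = 0)"

lemma zero_sum_rows_append:
  "zero_sum_rows k xs \<Longrightarrow> zero_sum_rows k ys \<Longrightarrow> zero_sum_rows k (xs @ ys)"
  by (auto simp: zero_sum_rows_def)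

lemma zero_sum_rows_concat:
  "(\<And>xs. xs \<in> set xss \<Longrightarrow> zero_sum_rows k xs) \<Longrightarrow> zero_sum_rows k (concat xss)"
  by (induction xss) (simp_all add: zero_sum_rows_append, simp add: zero_sum_rows_def)

lemma zero_sum_rows_array:
  assumes "zero_sum_rows k xs" "length xs = m" "E \<subseteq> set (concat xs)" "card E = m * k"
  shows "zero_sum_array m k E"
proof (rule zero_sum_arrayI[where A = "\<lambda>i j. xs ! i ! j"])
  show "E \<subseteq> (\<lambda>(i, j). xs ! i ! j) ` ({..<m} \<times> {..<k})"
  proof
    fix x assume "x \<in> E"
    then obtain r where "r \<in> set xs" "x \<in> set r" using assms(3) by auto
    then obtain i j where "i < m" "r = xs ! i" "j < length r" "x = r ! j"
      using assms(2) by (metis in_set_conv_nth)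
    moreover from this have "j < k" using assms(1,2) by (simp add: zero_sum_rows_def)
    ultimately show "x \<in> (\<lambda>(i, j). xs ! i ! j) ` ({..<m} \<times> {..<k})" by force
  qed
next
  fix i assume "i < m"
  then show "(\<Sum>j<k. xs ! i ! j) = 0"
    using assms(1,2) by (force simp: zero_sum_rows_def sum_list_sum_nth atLeast0LessThan dest: nth_mem)
next
  fix j assume "j < k"
  then show "(\<Sum>i<m. xs ! i ! j) = 0"
    using assms(1,2) by (simp add: zero_sum_rows_def sum_list_sum_nth atLeast0LessThan)
qed fact


lemma sma_of_rows:
  assumes "zero_sum_rows k xs" "length xs = m" "sma_entries m k \<subseteq> set (concat xs)"
  shows "zero_sum_array m k (sma_entries m k)"
  using zero_sum_rows_array[OF assms] card_sma_entries by blast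

section \<open>Small arrays given explicitly\<close>

lemma sma_3_3: "zero_sum_array 3 3 (sma_entries 3 3)"
  by (rule sma_of_rows[of _ "[[-4, 3, 1], [4, -1, -3], [0, -2, 2]]"])
    (code_simp, simp, simp add: sma_entries_alt, code_simp)

lemma sma_6_3: "zero_sum_array 6 3 (sma_entries 6 3)"
  by (rule sma_of_rows[of _ "[[9, -2, -7], [-1, 6, -5], [2, -6, 4], [-9, 1, 8], [7, -4, -3], [-8, 5, 3]]"])
    (code_simp, simp, simp add: sma_entries_alt, code_simp)

lemma sma_7_3: "zero_sum_array 7 3 (sma_entries 7 3)"
  by (rule sma_of_rows[of _ "[[1, -9, 8], [-4, -3, 7], [2, 4, -6], [-10, 10, 0], [3, 5, -8],
        [9, -2, -7], [-1, -5, 6]]"])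
    (code_simp, simp, simp add: sma_entries_alt, code_simp)

text \<open>The frame used below for five rows needs \<open>n >= 10\<close>.\<close>

lemma sma_5_6: "zero_sum_array 5 6 (sma_entries 5 6)"
  by (rule sma_of_rows[of _ "[[1, 2, 14, -14, -1, -2], [-15, 9, -10, 6, 15, -5],
        [11, -8, -4, 4, 8, -11], [-7, -6, 12, -3, -9, 13], [10, 3, -12, 7, -13, 5]]"])
    (code_simp, simp, simp add: sma_entries_alt, code_simp)

text \<open>Starting point when both sides are 2 modulo 4: growth cannot start from two rows, since
  no such array with 2 rows exists.\<close>

lemma sma_6_6: "zero_sum_array 6 6 (sma_entries 6 6)"
  by (rule sma_of_rows[of _ "[[13, -7, -2, 5, -5, -4], [-14, -11, 18, 17, 8, -18],
        [-10, 11, -16, 7, -8, 16], [15, 10, 4, -17, -15, 3], [-6, 9, -1, 1, 6, -9],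
        [2, -12, -3, -13, 14, 12]]"])
    (code_simp, simp, simp add: sma_entries_alt, code_simp)

text \<open>With \<open>e \<in> {s, s + 1}\<close>, \<open>f = 2 s + 1 + e\<close> and \<open>i = 1, \<dots>, s\<close>, the triples \<open>(-(e + i), e + 2 i, -i)\<close>
  and \<open>(i - f, f - 2 i, i)\<close> use each nonzero number of absolute value at most \<open>s\<close> or in
  \<open>{e + 1..e + 2 s}\<close> exactly once.  Blocks group them, with entries permuted, into zero-sum arrays.\<close>

definition block :: "int \<Rightarrow> int \<Rightarrow> int \<Rightarrow> int \<Rightarrow> int list list" where
  "block e f i j =
     [[- (e + i), e + 2 * i, - i], [e + 2 * j, - (e + j), - j],
      [i - f, f - 2 * i, i], [f - 2 * j, j - f, j]]"

definition triple_entries :: "int \<Rightarrow> int \<Rightarrow> int \<Rightarrow> int set" where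
  "triple_entries e f i = {- (e + i), e + 2 * i, - i, i - f, f - 2 * i, i}"

lemma less_3: "(j::nat) < 3 \<longleftrightarrow> j = 0 \<or> j = 1 \<or> j = 2" by auto

text \<open>In the first column the entries with \<open>i\<close> sum to \<open>-(e + f)\<close> and
  those with \<open>j\<close> to \<open>e + f\<close>; in the second column these roles are
  exchanged.\<close>

lemma zero_sum_rows_block: "zero_sum_rows 3 (block e f i j)"
  by (auto simp: zero_sum_rows_def block_def less_3)

lemma set_concat_block:
  "set (concat (block e f i j)) = triple_entries e f i \<union> triple_entries e f j"
  by (auto simp: block_def triple_entries_def)

definition blocks :: "int \<Rightarrow> int \<Rightarrow> int \<Rightarrow> nat \<Rightarrow> int list list" where
  "blocks e f a r = concat (map (\<lambda>k. block e f (a + 2 * int k) (a + 2 * int k + 1)) [0..<r])"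

lemma zero_sum_rows_blocks: "zero_sum_rows 3 (blocks e f a r)"
  unfolding blocks_def by (rule zero_sum_rows_concat) (auto simp: zero_sum_rows_block)

lemma length_blocks: "length (blocks e f a r) = 4 * r"
  by (induction r) (simp_all add: blocks_def block_def)

lemma triple_entries_blocks:
  assumes "a \<le> i" "i < a + 2 * int r"
  shows "triple_entries e f i \<subseteq> set (concat (blocks e f a r))"
proof -
  define k where "k = nat ((i - a) div 2)"
  have "i = a + 2 * int k \<or> i = a + 2 * int k + 1"
    using assms(1) unfolding k_def by simp presburger
  moreover from this have "k < r" using assms(2) by auto
  ultimately have k: "k < r" "i = a + 2 * int k \<or> i = a + 2 * int k + 1" by blast+
  have "triple_entries e f i \<subseteq> set (concat (block e f (a + 2 * int k) (a + 2 * int k + 1)))"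
    using k(2) set_concat_block by blast
  also have "\<dots> \<subseteq> set (concat (blocks e f a r))"
    using k(1) unfolding blocks_def by auto
  finally show ?thesis .
qed

text \<open>Among the large negative numbers, \<open>-(e + i)\<close> fills the inner half and
  \<open>i - f\<close> the outer half. Among the large positive ones, \<open>e + 2 i\<close> and
  \<open>f - 2 i\<close> fill the two parity classes of \<open>x - e\<close>.\<close>

lemma triple_entries_cover:
  assumes "\<And>i. 1 \<le> i \<Longrightarrow> i \<le> s \<Longrightarrow> triple_entries e (2 * s + 1 + e) i \<subseteq> X"
    and "\<bar>x\<bar> \<le> e + 2 * s" "x \<noteq> 0" "\<bar>x\<bar> \<le> s \<or> e < \<bar>x\<bar>" "0 \<le> e"
  shows "x \<in> X"
proof -
  have X: "\<And>i. 1 \<le> i \<Longrightarrow> i \<le> s \<Longrightarrow> y \<in> triple_entries e (2 * s + 1 + e) i \<Longrightarrow> y \<in> X" for y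
    using assms(1) by blast
  consider "\<bar>x\<bar> \<le> s" | "x < - (e + s)" | "- (e + s) \<le> x" "x < - e"
    | "e < x" "even (x - e)" | "e < x" "odd (x - e)"
    using assms(4) by linarith
  then show ?thesis
  proof cases
    case 1
    with assms show ?thesis by (intro X[of "\<bar>x\<bar>"]) (auto simp: triple_entries_def)
  next
    case 2
    with assms show ?thesis by (intro X[of "x + (2 * s + 1 + e)"]) (auto simp: triple_entries_def)
  next
    case 3
    with assms show ?thesis by (intro X[of "- x - e"]) (auto simp: triple_entries_def)
  next
    case 4
    then obtain i where "x - e = 2 * i" by blast
    with 4 assms show ?thesis by (intro X[of i]) (auto simp: triple_entries_def)
  next
    case 5
    then obtain i where "x - e = 2 * i + 1" by (blast elim: oddE)
    with 5 assms show ?thesis by (intro X[of "s - i"]) (auto simp: triple_entries_def)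
  qed
qed

lemma sma_even_3I:
  assumes "zero_sum_rows 3 xs" "length xs = 2 * s"
    and "\<And>i. 1 \<le> i \<Longrightarrow> i \<le> int s \<Longrightarrow> triple_entries (int s) (3 * int s + 1) i \<subseteq> set (concat xs)"
  shows "zero_sum_array (2 * s) 3 (sma_entries (2 * s) 3)"
proof (rule sma_of_rows[OF assms(1,2)], rule subsetI)
  fix x assume "x \<in> sma_entries (2 * s) 3"
  then have "\<bar>x\<bar> \<le> 3 * int s" "x \<noteq> 0" unfolding sma_entries_alt by auto
  then show "x \<in> set (concat xs)"
    using assms(3) by (intro triple_entries_cover[of "int s" "int s"]) auto
qed

text \<open>Taking \<open>e = s + 1\<close> instead of \<open>s\<close> leaves a gap at
  \<open>s + 1\<close> and its negative, which together with 0 form one additional row.\<close>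

lemma sma_odd_3I:
  assumes "zero_sum_rows 3 xs" "length xs = 2 * s + 1"
    and "\<And>i. 1 \<le> i \<Longrightarrow> i \<le> int s \<Longrightarrow> triple_entries (int s + 1) (3 * int s + 2) i \<subseteq> set (concat xs)"
    and "{0, int s + 1, - (int s + 1)} \<subseteq> set (concat xs)"
  shows "zero_sum_array (2 * s + 1) 3 (sma_entries (2 * s + 1) 3)"
proof (rule sma_of_rows[OF assms(1,2)], rule subsetI)
  fix x assume "x \<in> sma_entries (2 * s + 1) 3"
  then have x: "\<bar>x\<bar> \<le> 3 * int s + 1" unfolding sma_entries_alt by auto
  show "x \<in> set (concat xs)"
  proof (cases "x \<in> {0, int s + 1, - (int s + 1)}")
    case False
    with x assms(3) show ?thesis
      by (intro triple_entries_cover[of "int s" "int s + 1"]) (auto simp: algebra_simps)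
  qed (use assms(4) in blast)
qed

text \<open>In \<open>block5\<close> and \<open>block7\<close> the extra triple of \<open>0, e, -e\<close> has \<open>e\<close> in the last position;
  this is compensated by the \<open>-(e + i)\<close> there.\<close>

definition block5 :: "int \<Rightarrow> int \<Rightarrow> int \<Rightarrow> int \<Rightarrow> int list list" where
  "block5 e f i j =
     [[0, - e, e], [e + 2 * i, - i, - (e + i)], [- (e + j), e + 2 * j, - j],
      [f - 2 * i, i - f, i], [j - f, f - 2 * j, j]]"

definition block6 :: "int \<Rightarrow> int \<Rightarrow> int \<Rightarrow> int \<Rightarrow> int \<Rightarrow> int list list" where
  "block6 e f i j k =
     [[e + 2 * i, - (e + i), - i], [e + 2 * j, - (e + j), - j], [e + 2 * k, - (e + k), - k],
      [i - f, f - 2 * i, i], [j - f, f - 2 * j, j], [k - f, f - 2 * k, k]]"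

definition block7 :: "int \<Rightarrow> int \<Rightarrow> int \<Rightarrow> int \<Rightarrow> int \<Rightarrow> int list list" where
  "block7 e f i j k =
     [[0, - e, e],
      [e + 2 * i, - i, - (e + i)], [e + 2 * j, - (e + j), - j], [e + 2 * k, - (e + k), - k],
      [i - f, f - 2 * i, i], [j - f, f - 2 * j, j], [k - f, f - 2 * k, k]]"

lemma zero_sum_rows_block5: "zero_sum_rows 3 (block5 e f i j)"
  by (auto simp: zero_sum_rows_def block5_def less_3)

text \<open>These blocks absorb three indices at once. The first column sums to
  \<open>3 (e + i + j + k - f)\<close> and the second to its negative, whence the condition on
  \<open>i + j + k\<close>.\<close>

lemma zero_sum_rows_block67:
  assumes "i + j + k = f - e"
  shows "zero_sum_rows 3 (block6 e f i j k)" "zero_sum_rows 3 (block7 e f i j k)"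
proof -
  have "f = e + i + j + k" using assms by simp
  then show "zero_sum_rows 3 (block6 e f i j k)" "zero_sum_rows 3 (block7 e f i j k)"
    by (auto simp: zero_sum_rows_def block6_def block7_def less_3)
qed

lemma set_concat_block567:
  "set (concat (block5 e f i j)) = {0, e, - e} \<union> triple_entries e f i \<union> triple_entries e f j"
  "set (concat (block6 e f i j k)) =
     triple_entries e f i \<union> triple_entries e f j \<union> triple_entries e f k"
  "set (concat (block7 e f i j k)) =
     {0, e, - e} \<union> triple_entries e f i \<union> triple_entries e f j \<union> triple_entries e f k"
  by (auto simp: block5_def block6_def block7_def triple_entries_def)

text \<open>With \<open>n = 2 s\<close> or \<open>n = 2 s + 1\<close>, the indices
  \<open>1, ..., s\<close> are paired off. For odd \<open>s\<close> three of them go into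
  \<open>block6\<close> or \<open>block7\<close>, which needs \<open>s >= 5\<close>; this leaves 3,
  6 and 7 as explicit cases.\<close>

lemma sma_n_3:
  assumes "n \<ge> 3"
  shows "zero_sum_array n 3 (sma_entries n 3)"
proof -
  consider r where "n = 2 * (2 * r)" | r where "n = 2 * (2 * r + 2) + 1"
    | "n = 3" | "n = 6" | "n = 7"
    | r where "n = 2 * (2 * r + 5)" | r where "n = 2 * (2 * r + 5) + 1"
  proof -
    have "\<exists>r. n = 4 * r \<or> n = 4 * r + 5 \<or> n = 3 \<or> n = 6 \<or> n = 7 \<or> n = 4 * r + 10 \<or> n = 4 * r + 11"
      using assms by presburger
    then show ?thesis using that by force
  qed
  then show ?thesis
  proof cases
    case (1 r)
    let ?s = "int (2 * r)"
    show ?thesis unfolding 1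
    proof (rule sma_even_3I[where xs = "blocks ?s (3 * ?s + 1) 1 r"])
      fix i assume "1 \<le> i" "i \<le> ?s"
      then show "triple_entries ?s (3 * ?s + 1) i \<subseteq> set (concat (blocks ?s (3 * ?s + 1) 1 r))"
        by (intro triple_entries_blocks) auto
    qed (simp_all add: zero_sum_rows_blocks length_blocks)
  next
    case (2 r)
    let ?s = "int (2 * r + 2)"
    let ?e = "?s + 1" and ?f = "3 * ?s + 2"
    let ?xs = "block5 ?e ?f 1 2 @ blocks ?e ?f 3 r"
    show ?thesis unfolding 2
    proof (rule sma_odd_3I[where xs = ?xs])
      fix i assume "1 \<le> i" "i \<le> ?s"
      then consider "i = 1" | "i = 2" | "3 \<le> i" "i < 3 + 2 * int r" by fastforce
      then show "triple_entries ?e ?f i \<subseteq> set (concat ?xs)"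
        by cases (use triple_entries_blocks set_concat_block567 in \<open>fastforce+\<close>)
    next
      show "zero_sum_rows 3 ?xs"
        by (intro zero_sum_rows_append zero_sum_rows_block5 zero_sum_rows_blocks)
    next
      show "{0, ?e, - ?e} \<subseteq> set (concat ?xs)"
        unfolding concat_append set_append set_concat_block567 by blast
    qed (simp add: length_blocks block5_def)
  next
    case (6 r)
    let ?s = "int (2 * r + 5)"
    let ?e = "?s" and ?f = "3 * ?s + 1"
    \<comment> \<open>The indices \<open>2, s - 1, s\<close> have the required sum
      \<open>2 s + 1 = f - e\<close>; then 1 and 3 form a pair, and \<open>4, ..., s - 2\<close> are
      paired consecutively.\<close>
    let ?xs = "block6 ?e ?f 2 (?s - 1) ?s @ block ?e ?f 1 3 @ blocks ?e ?f 4 r"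
    show ?thesis unfolding 6
    proof (rule sma_even_3I[where xs = ?xs])
      fix i assume "1 \<le> i" "i \<le> ?s"
      then consider "i \<in> {1, 3}" | "i \<in> {2, ?s - 1, ?s}" | "4 \<le> i" "i < 4 + 2 * int r" by fastforce
      then show "triple_entries ?e ?f i \<subseteq> set (concat ?xs)"
        unfolding concat_append set_append set_concat_block567 set_concat_block
        by cases (use triple_entries_blocks in blast)+
    next
      show "zero_sum_rows 3 ?xs"
        by (intro zero_sum_rows_append zero_sum_rows_block67 zero_sum_rows_block zero_sum_rows_blocks)
          simp
    qed (simp add: length_blocks block6_def block_def)
  next
    case (7 r)
    let ?s = "int (2 * r + 5)"
    let ?e = "?s + 1" and ?f = "3 * ?s + 2"
    let ?xs = "block7 ?e ?f 2 (?s - 1) ?s @ block ?e ?f 1 3 @ blocks ?e ?f 4 r"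
    show ?thesis unfolding 7
    proof (rule sma_odd_3I[where xs = ?xs])
      fix i assume "1 \<le> i" "i \<le> ?s"
      then consider "i \<in> {1, 3}" | "i \<in> {2, ?s - 1, ?s}" | "4 \<le> i" "i < 4 + 2 * int r" by fastforce
      then show "triple_entries ?e ?f i \<subseteq> set (concat ?xs)"
        unfolding concat_append set_append set_concat_block567 set_concat_block
        by cases (use triple_entries_blocks in blast)+
    next
      show "zero_sum_rows 3 ?xs"
        by (intro zero_sum_rows_append zero_sum_rows_block67 zero_sum_rows_block zero_sum_rows_blocks)
          simp
    next
      show "{0, ?e, - ?e} \<subseteq> set (concat ?xs)"
        unfolding concat_append set_append set_concat_block567 by blast
    qed (simp add: length_blocks block7_def block_def)
  qed (simp_all add: sma_3_3 sma_6_3 sma_7_3)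
qed

section \<open>Frames\<close>

text \<open>Two rows cannot be added to a \<open>3 x n\<close> array here, so a frame with corners
  \<open>c + 1\<close> and \<open>-(c + 2)\<close> is put around a \<open>3 x (n - 2)\<close> array,
  where 4 divides \<open>n - 2\<close>.\<close>

lemma sma_5_n:
  assumes "n mod 4 = 2" "n \<ge> 6"
  shows "zero_sum_array 5 n (sma_entries 5 n)"
proof (cases "n = 6")
  case False
  define k where "k = n div 4"
  have n: "n = 4 * k + 2" and k: "k \<ge> 2" using assms False unfolding k_def by presburger+
  define c where "c = 6 * int k"
  have "signed_sum {c + 2 + 1..c + 2 + 2 * int (k + 1)} (- int ((k + 1) mod 2))"
    "signed_sum {c + 2 * int k + 5, c + 2 * int k + 7} (c + 2 * int k + 7 - (c + 2 * int k + 5))"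
    "signed_sum {c + 2 * int k + 7 + 1..c + 2 * int k + 7 + 2 * int (k - 2)} (- int ((k - 2) mod 2))"
    unfolding c_def by (rule signed_sum_interval signed_sum_pair; simp)+
  from signed_sum_Un[OF signed_sum_Un[OF this(1,2)] this(3)]
  have T: "signed_sum
      (({c + 2 + 1..c + 2 + 2 * int (k + 1)} \<union> {c + 2 * int k + 5, c + 2 * int k + 7}) \<union>
       {c + 2 * int k + 7 + 1..c + 2 * int k + 7 + 2 * int (k - 2)})
      (- int ((k + 1) mod 2) + (c + 2 * int k + 7 - (c + 2 * int k + 5)) + - int ((k - 2) mod 2))"
    (is "signed_sum ?T ?t") by auto
  \<comment> \<open>Exactly one of \<open>k + 1\<close> and \<open>k - 2\<close> is odd, so the two
    intervals contribute -1 in total and the pair at distance 2 raises the sum to the required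
    1.\<close>
  have t: "?t = - (c + 1) - (- (c + 2))" using k by (cases "even k") (auto simp: mod_2_eq_odd)
  have T: "signed_sum ?T (- (c + 1) - (- (c + 2)))" using T unfolding t .
  have "{c + 2 + 1..c + 2 + 2 * int (k + 1)} \<inter> {c + 2 * int k + 5, c + 2 * int k + 7} = {}"
    "({c + 2 + 1..c + 2 + 2 * int (k + 1)} \<union> {c + 2 * int k + 5, c + 2 * int k + 7})
      \<inter> {c + 2 * int k + 7 + 1..c + 2 * int k + 7 + 2 * int (k - 2)} = {}"
    by auto
  from card_Un_disjoint[OF _ _ this(1)] card_Un_disjoint[OF _ _ this(2)]
  have cardT: "card ?T = 4 * k" using k by (simp del: Un_insert_right Un_insert_left)
  \<comment> \<open>Signed \<open>+ - -\<close>, these sum to \<open>-c - 6 k - 3\<close>, which is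
    the required \<open>-(2 c + 3)\<close> because \<open>c = 6 k\<close>.\<close>
  let ?L = "{c + 2 * int k + 6, c + 4 * int k + 4, c + 4 * int k + 5}"
  have L: "signed_sum ?L (- (c + 2) - (c + 1))" unfolding signed_sum_def
    using k by (intro exI[of _ "{c + 2 * int k + 6, - (c + 4 * int k + 4), - (c + 4 * int k + 5)}"])
      (auto simp: c_def)
  have cardL: "card ?L = 3" using k by simp
  have "zero_sum_array (3 + 2) (4 * k + 2) (sma_entries 5 n)"
  proof (rule add_frame[OF _ T cardT L cardL])
    show "zero_sum_array 3 (4 * k) (sma_entries 3 (4 * k))"
      using k by (intro sma_transpose[OF sma_n_3]) simp
    have "sma_entries 5 n \<subseteq> sma_entries 3 (4 * k) \<union> (?T \<union> ?L \<union> {c + 1, c + 2})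
      \<union> uminus ` (?T \<union> ?L \<union> {c + 1, c + 2})"
    proof (rule sma_entries_subset)
      have "int (3 * (4 * k) div 2) = c" "int (5 * n div 2) = c + 4 * int k + 5"
        "int (k - 2) = int k - 2"
        using k by (simp_all add: n c_def)
      note ends = this
      show "{int (3 * (4 * k) div 2) + 1..int (5 * n div 2)} \<subseteq> ?T \<union> ?L \<union> {c + 1, c + 2}"
      proof
        fix x assume "x \<in> {int (3 * (4 * k) div 2) + 1..int (5 * n div 2)}"
        then have "c + 1 \<le> x" "x \<le> c + 4 * int k + 5" unfolding ends by auto
        then consider "x = c + 1 \<or> x = c + 2" | "c + 3 \<le> x" "x \<le> c + 2 * int k + 4"
          | "x = c + 2 * int k + 5 \<or> x = c + 2 * int k + 6 \<or> x = c + 2 * int k + 7"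
          | "c + 2 * int k + 8 \<le> x" "x \<le> c + 4 * int k + 3"
          | "x = c + 4 * int k + 4 \<or> x = c + 4 * int k + 5"
          by linarith
        then show "x \<in> ?T \<union> ?L \<union> {c + 1, c + 2}"
          unfolding ends atLeastAtMost_iff Un_iff insert_iff empty_iff by cases (simp; blast?)+
      qed
    qed (simp add: n)
    moreover have "\<bar>c + 1\<bar> = c + 1" "\<bar>- (c + 2)\<bar> = c + 2" by (simp_all add: c_def)
    ultimately show "sma_entries 5 n \<subseteq> sma_entries 3 (4 * k) \<union> (?T \<union> ?L \<union> {\<bar>c + 1\<bar>, \<bar>- (c + 2)\<bar>})
      \<union> uminus ` (?T \<union> ?L \<union> {\<bar>c + 1\<bar>, \<bar>- (c + 2)\<bar>})"
      by (simp only:)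
  qed (simp add: card_sma_entries n)
  then show ?thesis by (simp add: n)
qed (simp add: sma_5_6)

section \<open>Frames around arrays with both sides odd\<close>

lemma two_sum_int_interval:
  fixes a b :: int
  assumes "a \<le> b + 1"
  shows "2 * \<Sum>{a..b} = (a + b) * (b - a + 1)"
proof -
  have "2 * \<Sum>{a..a + int k - 1} = (2 * a + int k - 1) * int k" for k
  proof (induction k)
    case (Suc k)
    have "{a..a + int (Suc k) - 1} = insert (a + int k) {a..a + int k - 1}" by auto
    then show ?case using Suc by (simp add: algebra_simps)
  qed simp
  from this[of "nat (b - a + 1)"] show ?thesis using assms by (simp add: algebra_simps)
qed

text \<open>\<open>W\<close> consists of pairs \<open>c - x, c + x\<close>, with \<open>c\<close>
  itself added if \<open>d\<close> is odd. Dropping \<open>x = h\<close> still leaves at least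
  \<open>d div 2\<close> choices of \<open>x\<close> in \<open>1, ..., d\<close>.\<close>

lemma subset_sum_avoiding:
  fixes c h :: int
  assumes "0 < h"
  obtains W where "W \<subseteq> {c - int d..c + int d}" "card W = d" "\<Sum>W = int d * c" "c - h \<notin> W"
proof -
  have "d div 2 \<le> card ({1..int d} - {h})"
    by (cases "h \<le> int d") (use assms in auto)
  then obtain X where X: "X \<subseteq> {1..int d} - {h}" "card X = d div 2" "finite X"
    using obtain_subset_with_card_n by metis
  define W where "W = ((\<lambda>x. c - x) ` X \<union> (\<lambda>x. c + x) ` X) \<union> (if odd d then {c} else {})"
  have d: "(\<lambda>x. c - x) ` X \<inter> (\<lambda>x. c + x) ` X = {}" "c \<notin> (\<lambda>x. c - x) ` X \<union> (\<lambda>x. c + x) ` X"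
  proof -
    have "(\<lambda>x. c - x) ` X \<subseteq> {..<c}" "(\<lambda>x. c + x) ` X \<subseteq> {c<..}" using X(1) by auto
    then show "(\<lambda>x. c - x) ` X \<inter> (\<lambda>x. c + x) ` X = {}"
      "c \<notin> (\<lambda>x. c - x) ` X \<union> (\<lambda>x. c + x) ` X" by fastforce+
  qed
  have card: "card ((\<lambda>x. c - x) ` X \<union> (\<lambda>x. c + x) ` X) = 2 * (d div 2)"
    using X d(1) by (simp add: card_Un_disjoint card_image inj_on_def)
  have sum: "\<Sum>((\<lambda>x. c - x) ` X \<union> (\<lambda>x. c + x) ` X) = int (2 * (d div 2)) * c"
    using X d(1) by (simp add: sum.union_disjoint sum.reindex inj_on_def sum_subtractf sum.distrib)
  show ?thesis
  proof (rule that[of W])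
    show "W \<subseteq> {c - int d..c + int d}" using X(1) unfolding W_def by auto
    show "c - h \<notin> W" using X(1) assms unfolding W_def by auto
    show "card W = d" using X(3) d(2) card by (simp add: W_def odd_two_times_div_two_succ)
    show "\<Sum>W = int d * c"
    proof (cases "odd d")
      case True
      then have "int d = 2 * int (d div 2) + 1" by presburger
      then show ?thesis using True X(3) d(2) sum by (simp add: W_def algebra_simps)
    next
      case False
      then show ?thesis using sum by (simp add: W_def)
    qed
  qed
qed

text \<open>In the frame of a \<open>(2 M - 1) \<times> (2 N - 1)\<close> array the corners are \<open>\<plusminus>(c + M)\<close> and \<open>\<plusminus>(c + N + 2)\<close>.
  The short side takes the smallest new numbers with sign \<open>+\<close> and large ones with sign \<open>-\<close>, and
  its balance forces the second corner.  On the long side the largest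
  \<open>M\<close> numbers \<open>?U\<close> are negative; the choice of the first corner makes the mean of the remaining
  \<open>d = N - M\<close> negative ones equal to \<open>c + M + N + 1\<close>, so that a set \<open>W\<close> symmetric about this value
  works.\<close>

lemma sma_odd_frame:
  assumes "1 \<le> a" "a \<le> b"
    and A: "zero_sum_array (2 * a + 1) (2 * b + 1) (sma_entries (2 * a + 1) (2 * b + 1))"
  shows "zero_sum_array (2 * a + 3) (2 * b + 3) (sma_entries (2 * a + 3) (2 * b + 3))"
proof -
  define M N where "M = int a + 1" and "N = int b + 1"
  define c where "c = 2 * M * N - M - N"
  define d where "d = b - a"
  have MN: "2 \<le> M" "M \<le> N" "int d = N - M" using assms by (simp_all add: M_def N_def d_def)
  have c: "int ((2 * a + 1) * (2 * b + 1) div 2) = c"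
    "int ((2 * a + 3) * (2 * b + 3) div 2) = c + 2 * M + 2 * N"
  proof -
    have "(2 * a + 1) * (2 * b + 1) = 2 * (2 * a * b + a + b) + 1"
      "(2 * a + 3) * (2 * b + 3) = 2 * (2 * a * b + 3 * a + 3 * b + 4) + 1"
      by (simp_all add: algebra_simps)
    then have "(2 * a + 1) * (2 * b + 1) div 2 = 2 * a * b + a + b"
      "(2 * a + 3) * (2 * b + 3) div 2 = 2 * a * b + 3 * a + 3 * b + 4"
      by simp_all
    then show "int ((2 * a + 1) * (2 * b + 1) div 2) = c"
      "int ((2 * a + 3) * (2 * b + 3) div 2) = c + 2 * M + 2 * N"
      unfolding c_def M_def N_def by (simp_all add: algebra_simps)
  qed
  have c0: "0 \<le> c" unfolding c(1)[symmetric] by (rule of_nat_0_le_iff)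
  define p q where "p = c + M" and "q = c + N + 2"
  \<comment> \<open>The corner \<open>q\<close> lies \<open>M - 1\<close> below the centre
    \<open>c + M + N + 1\<close> of \<open>W\<close>, so this is the distance to avoid.\<close>
  have "0 < M - 1" using MN by simp
  then obtain W where W: "W \<subseteq> {c + M + N + 1 - int d..c + M + N + 1 + int d}" "card W = d"
    "\<Sum>W = int d * (c + M + N + 1)" "c + M + N + 1 - (M - 1) \<notin> W"
    by (rule subset_sum_avoiding[of "M - 1" "c + M + N + 1" d])
  have "finite W" using W(1) finite_subset by blast
  moreover have q_nin: "q \<notin> W" using W(4) by (simp add: q_def algebra_simps)
  moreover have "W \<subseteq> {c + M + 2..c + 2 * N + 1} - {q}"
    using W(1) q_nin MN unfolding MN(3) by force
  ultimately have W': "finite W" "q \<notin> W" "W \<subseteq> {c + M + 2..c + 2 * N + 1} - {q}" by blast+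

  \<comment> \<open>The new numbers form four consecutive intervals of lengths \<open>M + 1\<close>,
    \<open>2 N - M\<close>, \<open>M - 1\<close> and \<open>M\<close>: positive \<open>L\<close>
    with \<open>p\<close>, then \<open>?C\<close> with \<open>q\<close>, then negative
    \<open>L\<close>, then \<open>?U\<close>.\<close>
  let ?C = "{c + M + 2..c + 2 * N + 1}" and ?U = "{c + 2 * N + M + 1..c + 2 * N + 2 * M}"
  let ?TP = "?C - {q} - W" and ?TN = "W \<union> ?U"
  have q: "q \<in> ?C" using MN by (simp add: q_def)
  have UW: "W \<inter> ?U = {}" using W'(3) MN by fastforce
  have cardC: "card (?C - {q} - W) = nat (2 * N - M - 1 - int d)"
    using q W' W(2) by (simp add: card_Diff_subset)
  have "card (?TP \<union> ?TN) = card ?TP + (card W + card ?U)"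
    using W' UW MN by (subst card_Un_disjoint) (auto simp: card_Un_disjoint)
  then have cardT: "card (?TP \<union> ?TN) = 2 * b + 1"
    using cardC W(2) MN by (simp add: M_def N_def)
  have T': "signed_sum (?TP \<union> ?TN) (\<Sum>?TP + - \<Sum>?TN)"
    by (rule signed_sum_Un[OF signed_sum_pos signed_sum_neg]) (use W' MN c0 in auto)
  have "\<Sum>?TP = \<Sum>?C - q - \<Sum>W"
    using W' q by (simp add: sum_diff sum_diff1)
  moreover have "\<Sum>?TN = \<Sum>W + \<Sum>?U" using W' UW by (simp add: sum.union_disjoint)
  \<comment> \<open>The signs leave only one \<open>-c\<close> on the left against
    \<open>-2 c\<close> on the right; the other comes from the products of \<open>M\<close> and
    \<open>N\<close> via \<open>c = 2 M N - M - N\<close>.\<close>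
  moreover have "\<Sum>?C - q - \<Sum>W - (\<Sum>W + \<Sum>?U) = - p - q"
    using two_sum_int_interval[of "c + M + 2" "c + 2 * N + 1"]
      two_sum_int_interval[of "c + 2 * N + M + 1" "c + 2 * N + 2 * M"] MN(1,2)
    unfolding W(3) MN(3) p_def q_def c_def by (simp add: algebra_simps)
  ultimately have "\<Sum>?TP + - \<Sum>?TN = - p - q" by linarith
  with T' have T: "signed_sum (?TP \<union> ?TN) (- p - q)" by (simp only:)

  let ?LP = "{c + 1..c + M + 1} - {p}" and ?LN = "{c + 2 * N + 2..c + 2 * N + M}"
  have p: "p \<in> {c + 1..c + M + 1}" using MN by (simp add: p_def)
  have "card (?LP \<union> ?LN) = card ?LP + card ?LN"
    using MN by (intro card_Un_disjoint) auto
  then have cardL: "card (?LP \<union> ?LN) = 2 * a + 1"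
    using p MN by (simp add: M_def)
  have L': "signed_sum (?LP \<union> ?LN) (\<Sum>?LP + - \<Sum>?LN)"
    by (rule signed_sum_Un[OF signed_sum_pos signed_sum_neg]) (use MN c0 in auto)
  have "\<Sum>?LP = \<Sum>{c + 1..c + M + 1} - p"
    using p by (simp add: sum_diff1)
  moreover have "\<Sum>{c + 1..c + M + 1} - p - \<Sum>?LN = q - p"
    using two_sum_int_interval[of "c + 1" "c + M + 1"]
      two_sum_int_interval[of "c + 2 * N + 2" "c + 2 * N + M"] MN(1,2)
    unfolding p_def q_def c_def by (simp add: algebra_simps)
  ultimately have "\<Sum>?LP + - \<Sum>?LN = q - p" by linarith
  with L' have L: "signed_sum (?LP \<union> ?LN) (q - p)" by (simp only:)

  let ?S = "?TP \<union> ?TN \<union> (?LP \<union> ?LN) \<union> {p, q}"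
  have "sma_entries (2 * a + 3) (2 * b + 3) \<subseteq>
    sma_entries (2 * a + 1) (2 * b + 1) \<union> ?S \<union> uminus ` ?S"
    by (rule sma_entries_subset) (unfold c, auto)
  moreover have "\<bar>p\<bar> = p" "\<bar>q\<bar> = q" using c0 MN by (simp_all add: p_def q_def)
  ultimately have "zero_sum_array (2 * a + 1 + 2) (2 * b + 1 + 2) (sma_entries (2 * a + 3) (2 * b + 3))"
    by (intro add_frame[OF A T cardT L cardL]) (simp_all only: card_sma_entries, simp add: algebra_simps)
  then show ?thesis by (simp add: numeral_eq_Suc)
qed

text \<open>Each frame enlarges both sides by 2, so removing frames ends at three rows.\<close>

lemma sma_odd_odd:
  assumes "1 \<le> a" "a \<le> b"
  shows "zero_sum_array (2 * a + 1) (2 * b + 1) (sma_entries (2 * a + 1) (2 * b + 1))"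
  using assms
proof (induction a arbitrary: b rule: nat_induct_at_least)
  case base
  then show ?case using sma_transpose[OF sma_n_3[of "2 * b + 1"]] by simp
next
  case (Suc a)
  then obtain b' where b: "b = Suc b'" "a \<le> b'" by (cases b) auto
  have e: "2 * Suc a + 1 = 2 * a + 3" "2 * b + 1 = 2 * b' + 3" by (simp_all add: b)
  show ?case unfolding e by (rule sma_odd_frame[OF Suc.hyps b(2) Suc.IH[OF b(2)]])
qed

section \<open>The existence theorem\<close>

text \<open>A column of one cell forces the entry 0, which may occur only once.\<close>

lemma zero_sum_array_one_row:
  assumes "zero_sum_array 1 n E"
  shows "n \<le> 1"
proof -
  obtain A where A: "bij_betw (\<lambda>(i, j). A i j) ({..<1::nat} \<times> {..<n}) E"
    and "\<forall>j<n. (\<Sum>i<1::nat. A i j) = 0"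
    using assms unfolding zero_sum_array_def by blast
  then have "E \<subseteq> {0}" unfolding bij_betw_def by auto
  then have "card E \<le> 1" using card_mono[of "{0}" E] by simp
  then show ?thesis using bij_betw_same_card[OF A] by simp
qed

lemma sma_two_rows_iff: "zero_sum_array 2 n (sma_entries 2 n) \<longleftrightarrow> n mod 4 = 0 \<or> n mod 4 = 3"
proof
  assume "zero_sum_array 2 n (sma_entries 2 n)"
  then obtain A :: "nat \<Rightarrow> nat \<Rightarrow> int"
    where A: "sma_entries 2 n = (\<lambda>(i, j). A i j) ` ({..<2} \<times> {..<n})"
    "\<And>i. i < 2 \<Longrightarrow> (\<Sum>j<n. A i j) = 0" "\<And>j. j < n \<Longrightarrow> (\<Sum>i<2. A i j) = 0"
    using zero_sum_arrayE by metis
  define f where "f = A 0"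
  have f: "\<bar>A i j\<bar> = \<bar>f j\<bar>" if "i < 2" "j < n" for i j
    using A(3)[OF that(2)] that(1) by (auto simp: f_def numeral_2_eq_2 less_Suc_eq)
  have e: "sma_entries 2 n = {- int n..int n} - {0}" by (simp add: sma_entries_alt)
  have im: "(\<lambda>j. \<bar>f j\<bar>) ` {..<n} = {1..int n}"
  proof (intro equalityI subsetI)
    fix x assume "x \<in> (\<lambda>j. \<bar>f j\<bar>) ` {..<n}"
    then obtain j where j: "j < n" "x = \<bar>f j\<bar>" by blast
    then have "f j \<in> sma_entries 2 n" unfolding A(1) f_def by force
    with j show "x \<in> {1..int n}" unfolding e by auto
  next
    fix x assume x: "x \<in> {1..int n}"
    then have "x \<in> sma_entries 2 n" unfolding e by auto
    then obtain i j where "i < 2" "j < n" "x = A i j" unfolding A(1) by auto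
    then have "j < n" "x = \<bar>f j\<bar>" using f[of i j] x by auto
    then show "x \<in> (\<lambda>j. \<bar>f j\<bar>) ` {..<n}" by blast
  qed
  then have inj: "inj_on (\<lambda>j. \<bar>f j\<bar>) {..<n}" by (intro eq_card_imp_inj_on) auto
  \<comment> \<open>Adding the zero sum of \<open>f\<close> turns each summand into
    \<open>|x| + x\<close>, which is even.\<close>
  have "\<Sum>{1..int n} = (\<Sum>j<n. \<bar>f j\<bar>) + (\<Sum>j<n. f j)"
    using sum.reindex[OF inj, of "\<lambda>x. x"] im A(2)[of 0] by (simp add: f_def)
  also have "even \<dots>" unfolding sum.distrib[symmetric] by (intro dvd_sum) (auto simp: abs_if)
  finally obtain k where "\<Sum>{1..int n} = 2 * k" by blast
  then have "int (n * (n + 1)) = int 4 * k"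
    using two_sum_int_interval[of 1 "int n"] by (simp add: algebra_simps)
  then have "4 dvd n * (n + 1)" by (metis dvd_triv_left int_dvd_int_iff)
  then show "n mod 4 = 0 \<or> n mod 4 = 3"
  proof -
    have "n mod 4 < 4" by simp
    then consider "n mod 4 = 0" | "n mod 4 = 1" | "n mod 4 = 2" | "n mod 4 = 3" by linarith
    then show ?thesis
      using \<open>4 dvd n * (n + 1)\<close> mod_mult_eq[of n 4 "n + 1"] mod_add_left_eq[of n 4 1]
      by cases (auto simp: dvd_eq_mod_eq_0)
  qed
next
  assume n: "n mod 4 = 0 \<or> n mod 4 = 3"
  have S: "signed_sum {1..int n} 0"
  proof (cases "n mod 4 = 0")
    case True
    then obtain k where "n = 4 * k" by auto
    then show ?thesis using signed_sum_interval[of 0 "2 * k"] by simp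
  next
    case False
    define k where "k = n div 4"
    have k: "n = 4 * k + 3" using False n unfolding k_def by presburger
    have "signed_sum {1, 2, 3} 0" unfolding signed_sum_def
      by (intro exI[of _ "{1, 2, -3}"]) auto
    from signed_sum_Un[OF this, of "{3 + 1..3 + 2 * int (2 * k)}"]
    have "signed_sum ({1, 2, 3} \<union> {4..3 + 4 * int k}) 0"
      using signed_sum_interval[of 3 "2 * k"] by simp
    also have "{1, 2, 3} \<union> {4..3 + 4 * int k} = {1..int n}" by (auto simp: k)
    finally show ?thesis .
  qed
  \<comment> \<open>The row and its negative are appended to the empty array.\<close>
  have "zero_sum_array (0 + 2) n (sma_entries 2 n)"
    by (rule add_two_rows[OF zero_sum_array_0 S _ sma_entries_subset])
      (auto simp: card_sma_entries)
  then show "zero_sum_array 2 n (sma_entries 2 n)" by (simp add: numeral_2_eq_2)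
qed

section \<open>Arrays with an even side\<close>

lemma sma_4_dvd:
  assumes "4 dvd n" "n > 0" "m \<ge> 2"
  shows "zero_sum_array m n (sma_entries m n)"
  using assms(3)
proof (induction m rule: less_induct)
  case (less m)
  have "4 \<le> n" using assms(1,2) by (simp add: dvd_imp_le)
  \<comment> \<open>Removing two rows at a time ends at two or three rows, both available when 4
    divides \<open>n\<close>.\<close>
  consider "m = 2" | "m = 3" | "m \<ge> 4" using less.prems by linarith
  then show ?case
  proof cases
    case 1
    then show ?thesis using assms(1) sma_two_rows_iff by auto
  next
    case 2
    then show ?thesis using sma_transpose[OF sma_n_3] \<open>4 \<le> n\<close> by simp
  next
    case 3
    then have "zero_sum_array (m - 2 + 2) n (sma_entries (m - 2 + 2) n)"
      by (intro sma_add_2_rows assms less.IH) auto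
    moreover have "m - 2 + 2 = m" using 3 by simp
    ultimately show ?thesis by metis
  qed
qed

lemma sma_2_mod_4_step:
  assumes n: "n mod 4 = 2" "n \<ge> 6" and A: "zero_sum_array l n (sma_entries l n)"
    and m: "l \<le> m" "m mod 4 = l mod 4"
  shows "zero_sum_array m n (sma_entries m n)"
proof -
  have step: "zero_sum_array (l + 4 * k) n (sma_entries (l + 4 * k) n)" for k
  proof (induction k)
    case (Suc k)
    have "l + 4 * Suc k = l + 4 * k + 4" by simp
    then show ?case using sma_add_4_rows[OF n Suc] by (simp only:)
  qed (use A in simp)
  have "4 dvd m - l" using m mod_eq_dvd_iff_nat by blast
  then obtain k where "m - l = 4 * k" by blast
  then have "m = l + 4 * k" using m by simp
  then show ?thesis using step by (simp only:)
qed

text \<open>Rows grow by four from 5, 6 or 3 according to \<open>m\<close> modulo 4; if 4 divides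
  \<open>m\<close>, the transposed array is already known.\<close>

lemma sma_2_mod_4:
  assumes n: "n mod 4 = 2" and m: "m > 2" and "n > 2"
  shows "zero_sum_array m n (sma_entries m n)"
proof -
  have n6: "n \<ge> 6" using assms by presburger
  note step = sma_2_mod_4_step[OF n n6]
  have "4 dvd m \<or> (m \<ge> 5 \<and> m mod 4 = 1) \<or> (m \<ge> 6 \<and> m mod 4 = 2) \<or> m mod 4 = 3"
    using m by presburger
  then consider "4 dvd m" | "m \<ge> 5" "m mod 4 = 1" | "m \<ge> 6" "m mod 4 = 2" | "m mod 4 = 3"
    by blast
  then show ?thesis
  proof cases
    case 1
    then show ?thesis using sma_transpose[OF sma_4_dvd[of m n]] m \<open>n > 2\<close> by simp
  next
    case 2
    then show ?thesis using step[OF sma_5_n[OF n n6]] by simp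
  next
    case 3
    \<comment> \<open>The \<open>6 x 6\<close> array grows to \<open>n x 6\<close> and is
      transposed; afterwards it can grow in the other direction.\<close>
    have "zero_sum_array 6 n (sma_entries 6 n)"
      using sma_transpose[OF sma_2_mod_4_step[OF _ _ sma_6_6 n6]] n by simp
    then show ?thesis using step 3 by simp
  next
    case 4
    then show ?thesis using step[OF sma_transpose[OF sma_n_3]] m \<open>n > 2\<close> by simp
  qed
qed

lemma sma_exists:
  assumes "m > 2" "n > 2"
  shows "zero_sum_array m n (sma_entries m n)"
proof -
  have even: "zero_sum_array m n (sma_entries m n)" if "even n" "m > 2" "n > 2" for m n
  proof (cases "4 dvd n")
    case True
    then show ?thesis using sma_4_dvd that by simp
  next
    case False
    then have "n mod 4 = 2" using \<open>even n\<close> by presburger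
    then show ?thesis using sma_2_mod_4 that by blast
  qed
  consider "even n" | "even m" | "odd m" "odd n" by blast
  then show ?thesis
  proof cases
    case 3
    then obtain a b where "m = 2 * a + 1" "n = 2 * b + 1" by (blast elim: oddE)
    then show ?thesis
      using sma_odd_odd[of a b] sma_transpose[OF sma_odd_odd[of b a]] assms by (cases "a \<le> b") auto
  qed (use even sma_transpose assms in blast)+
qed

lemma sma_commute:
  "zero_sum_array m n (sma_entries m n) \<longleftrightarrow> zero_sum_array n m (sma_entries n m)"
  using sma_transpose by blast

theorem theorem4:
  fixes m n :: nat
  assumes "m > 0" and "n > 0"
  shows "(\<exists>A. tight_signed_magic_array m n A) \<longleftrightarrow>
           (m = 1 \<and> n = 1) \<or>
           (m = 2 \<and> (n mod 4 = 0 \<or> n mod 4 = 3)) \<or>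
           (n = 2 \<and> (m mod 4 = 0 \<or> m mod 4 = 3)) \<or>
           (m > 2 \<and> n > 2)"
proof -
  have one: "zero_sum_array 1 k (sma_entries 1 k) \<longleftrightarrow> k = 1" if "k > 0" for k
  proof
    assume "k = 1"
    then show "zero_sum_array 1 k (sma_entries 1 k)"
      by (intro zero_sum_arrayI[where A = "\<lambda>_ _. 0"]) (auto simp: sma_entries_alt)
  qed (use that zero_sum_array_one_row in fastforce)
  consider "m = 1" | "n = 1" | "m = 2" "n > 1" | "n = 2" "m > 1" | "m > 2" "n > 2"
    using assms by linarith
  then show ?thesis
  proof cases
    case 1
    with one[OF assms(2)] show ?thesis unfolding ex_tight_iff by auto
  next
    case 2
    with one[OF assms(1)] show ?thesis unfolding ex_tight_iff sma_commute[of m n] by auto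
  next
    case 3
    then show ?thesis unfolding ex_tight_iff using sma_two_rows_iff[of n] by auto
  next
    case 4
    then show ?thesis unfolding ex_tight_iff sma_commute[of m n] using sma_two_rows_iff[of m] by auto
  next
    case 5
    then show ?thesis unfolding ex_tight_iff using sma_exists by simp
  qed
qed

end
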